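(* For every connected graph $G$ on $n\ge2$ vertices, $\hat{t}(G)\le 2n-3$.
   Context: Graphs are finite and simple. An improper edge coloring of $G$ is any map $\alpha:E(G)\to\mathbb{N}$; it is an improper interval edge coloring if for every vertex $v$ the set of colors on the edges incident with $v$ is a set of consecutive integers. $\hat{t}(G)$ denotes the maximum number of (distinct) colors used in an improper interval edge coloring of $G$. *)

theory Defs
  imports "Graph_Theory.Graph_Theory"
begin

text \<open>
  Finite simple graphs are the library's \<open>pair_graph\<close>s: finite, loop-free, symmetric digraphs
  whose arcs are ordered pairs of vertices. The two arcs \<open>(u, v)\<close> and \<open>(v, u)\<close> form a single
  undirected edge \<open>{u, v}\<close>, and it is these edges that are coloured.
\<close>

definition edges :: "'a pair_pre_digraph \<Rightarrow> 'a set set" where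
  "edges G = {{u, v} |u v. (u, v) \<in> parcs G}"

definition incident_edges :: "'a pair_pre_digraph \<Rightarrow> 'a \<Rightarrow> 'a set set" where
  "incident_edges G v = {e \<in> edges G. v \<in> e}"

text \<open>
  A colouring is a total function on vertex sets of which only the values on \<open>edges G\<close> matter.
  Adjacent edges may have the same colour. The interval \<open>{a..b}\<close> is empty for \<open>b < a\<close>, so
  isolated vertices impose no condition.
\<close>

definition improper_interval_coloring :: "'a pair_pre_digraph \<Rightarrow> ('a set \<Rightarrow> nat) \<Rightarrow> bool" where
  "improper_interval_coloring G \<alpha> \<longleftrightarrow>
     (\<forall>v \<in> pverts G. \<exists>a b. \<alpha> ` incident_edges G v = {a..b})"

definition t_hat :: "'a pair_pre_digraph \<Rightarrow> nat" where
  "t_hat G = Max {card (\<alpha> ` edges G) |\<alpha>. improper_interval_coloring G \<alpha>}"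

text \<open>The maximum is taken over a finite nonempty set, so it is attained.\<close>

lemma finite_edges:
  assumes "pair_graph G"
  shows "finite (edges G)"
proof -
  interpret pair_graph G by fact
  have "edges G = (\<lambda>(u, v). {u, v}) ` parcs G"
    by (auto simp: edges_def)
  then show ?thesis by simp
qed

lemma finite_color_counts:
  assumes "pair_graph G"
  shows "finite {card (\<alpha> ` edges G) |\<alpha>. improper_interval_coloring G \<alpha>}"
  by (rule finite_subset[of _ "{..card (edges G)}"])
     (auto intro: card_image_le finite_edges[OF assms])

lemma improper_interval_coloring_const: "improper_interval_coloring G (\<lambda>_. c)"
  unfolding improper_interval_coloring_def
proof
  fix v
  show "\<exists>a b. (\<lambda>_. c) ` incident_edges G v = {a..b}"
  proof (cases "incident_edges G v = {}")
    case True
    then show ?thesis by (intro exI[of _ 1] exI[of _ 0]) simp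
  next
    case False
    then show ?thesis by (intro exI[of _ c]) auto
  qed
qed

lemma t_hat_attained:
  assumes "pair_graph G"
  shows "\<exists>\<alpha>. improper_interval_coloring G \<alpha> \<and> t_hat G = card (\<alpha> ` edges G)"
proof -
  have "t_hat G \<in> {card (\<alpha> ` edges G) |\<alpha>. improper_interval_coloring G \<alpha>}"
    unfolding t_hat_def
    using finite_color_counts[OF assms] improper_interval_coloring_const
    by (intro Max_in) auto
  then show ?thesis by auto
qed

lemma t_hat_upper:
  assumes "pair_graph G" and "improper_interval_coloring G \<alpha>"
  shows "card (\<alpha> ` edges G) \<le> t_hat G"
  unfolding t_hat_def using finite_color_counts[OF assms(1)] assms(2) by (intro Max_ge) auto

end

theory Submission
  imports Defs
begin

text \<open>
  Let \<open>I v\<close> be the interval of colors at \<open>v\<close>. Cover all colors greedily: start with the smallest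
  color \<open>x\<^sub>0\<close>, and let \<open>x\<^sub>i\<^sub>+\<^sub>1\<close> be the largest color seen at a vertex whose interval starts at or
  below \<open>x\<^sub>i\<close>; connectedness gives \<open>x\<^sub>i < x\<^sub>i\<^sub>+\<^sub>1\<close> until the largest color is reached. Let block \<open>i\<close>
  consist of the colors \<open>c\<close> with \<open>x\<^sub>i < c \<le> x\<^sub>i\<^sub>+\<^sub>1\<close>, and of \<open>x\<^sub>0\<close> too if \<open>i = 0\<close>. Each of them occurs
  at the \<open>i\<close>-th vertex \<open>v\<^sub>i\<close> of the cover; charge it to the other end of an edge of color \<open>c\<close> at \<open>v\<^sub>i\<close>. Colors of one block go to distinct vertices, and by
  greediness no interval meets two blocks that are not consecutive, so every vertex is charged at
  most twice. For the same reason \<open>v\<^sub>j\<close> is charged only from block \<open>j - 1\<close>, so \<open>v\<^sub>0\<close> is never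
  charged and \<open>v\<^sub>1\<close> at most once, which gives \<open>2 (n - 2) + 1\<close> colors. If there is only one block,
  there are at most \<open>n - 1\<close> colors.
\<close>

lemma greedy_cover_bound:
  fixes V :: "'a set" and I :: "'a \<Rightarrow> nat set" and col :: "'a \<Rightarrow> 'a \<Rightarrow> nat"
  assumes fin: "finite V" "finite C" and ne: "C \<noteq> {}"
    and sub: "\<And>v. v \<in> V \<Longrightarrow> I v \<subseteq> C"
    and conv: "\<And>v a b c. v \<in> V \<Longrightarrow> a \<in> I v \<Longrightarrow> b \<in> I v \<Longrightarrow> a \<le> c \<Longrightarrow> c \<le> b \<Longrightarrow> c \<in> I v"
    and cov: "\<And>c. c \<in> C \<Longrightarrow> \<exists>v\<in>V. c \<in> I v"
    and bridge: "\<And>c. c \<in> C \<Longrightarrow> c < Max C \<Longrightarrow> \<exists>v\<in>V. \<exists>a\<in>I v. \<exists>b\<in>I v. a \<le> c \<and> c < b"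
    and nbr: "\<And>v c. v \<in> V \<Longrightarrow> c \<in> I v \<Longrightarrow> \<exists>w\<in>V. w \<noteq> v \<and> c \<in> I w \<and> col v w = c"
    and n2: "card V \<ge> 2"
  shows "card C \<le> 2 * card V - 3"
proof -
  define m where "m = Min C"
  have m: "m \<in> C" "\<And>c. c \<in> C \<Longrightarrow> m \<le> c"
    using fin ne by (auto simp: m_def)
  \<comment> \<open>The interval of \<open>v\<close> need not contain \<open>c\<close>; it may lie
    wholly below. So every interval that starts at or below \<open>c\<close> ends at or below
    \<open>R c\<close>.\<close>
  define S where "S c = {d. \<exists>v\<in>V. d \<in> I v \<and> (\<exists>a\<in>I v. a \<le> c)}" for c
  define R where "R c = Max (S c)" for c
  define x where "x i = (R ^^ i) m" for i
  have x0: "x 0 = m" and xS: "x (Suc i) = R (x i)" for i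
    by (auto simp: x_def)
  have SC: "S c \<subseteq> C" for c using sub by (auto simp: S_def)
  have finS: "finite (S c)" for c using SC fin finite_subset by blast
  have mS: "m \<in> S c" if "m \<le> c" for c
    using cov[OF m(1)] that by (auto simp: S_def)
  have R_in: "R c \<in> S c" if "m \<le> c" for c
    unfolding R_def using finS mS[OF that] by (intro Max_in) auto
  have R_ge: "d \<le> R c" if "d \<in> S c" for c d
    unfolding R_def using finS that by simp
  have R_step: "c < R c" if "c \<in> C" "c < Max C" for c
    using bridge[OF that] R_ge[of _ c] by (fastforce simp: S_def)
  have xC: "x i \<in> C" for i
  proof (induction i)
    case 0 then show ?case using m x0 by simp
  next
    case (Suc i) then show ?case using R_in[of "x i"] m SC by (auto simp: xS)
  qed
  have x_ge: "m \<le> x i" for i using xC m by blast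
  have x_step: "x i \<le> x (Suc i)" for i
  proof (cases "x i < Max C")
    case True then show ?thesis using R_step[OF xC] by (simp add: xS less_imp_le)
  next
    case False
    then have "x i = Max C" using xC fin by (simp add: order_antisym)
    moreover obtain v where "v \<in> V" "x i \<in> I v" using cov xC by blast
    ultimately show ?thesis unfolding xS by (intro R_ge) (auto simp: S_def)
  qed
  have x_mono: "x i \<le> x j" if "i \<le> j" for i j
    using lift_Suc_mono_le[of x, OF x_step that] .
  \<comment> \<open>Below \<open>Max C\<close> each step gains at least 1, so \<open>Max C\<close>
    is reached within \<open>Max C\<close> steps and every color gets a block.\<close>
  have x_large: "min i (Max C) \<le> x i" for i
  proof (induction i)
    case (Suc i)
    then show ?case using R_step[OF xC[of i]] x_step[of i] by (cases "x i < Max C") (auto simp: xS)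
  qed simp
  have ex: "\<exists>i. c \<le> x (Suc i)" if "c \<in> C" for c
  proof -
    have "c \<le> Max C" using that fin by simp
    then show ?thesis using x_large[of "Suc (Max C)"] by (intro exI[of _ "Max C"]) simp
  qed
  define blk where "blk c = (LEAST i. c \<le> x (Suc i))" for c
  have blk_le: "c \<le> x (Suc (blk c))" if "c \<in> C" for c
    unfolding blk_def using LeastI_ex[OF ex[OF that]] .
  \<comment> \<open>Minimality of \<open>blk c\<close> is used at \<open>i - 1\<close>. The case
    \<open>i = 0\<close> must be excluded, since \<open>x 0\<close> itself lies in block 0.\<close>
  have blk_gt: "x i < c" if "i \<le> blk c" "0 < i" for c i
  proof -
    have "i - 1 < blk c" using that by simp
    from not_less_Least[OF this[unfolded blk_def]] that show ?thesis by simp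
  qed
  have "\<exists>v\<in>V. x (Suc i) \<in> I v \<and> (\<exists>a\<in>I v. a \<le> x i)" for i
    using R_in[OF x_ge] by (simp add: xS S_def)
  then obtain ctr where ctr: "\<And>i. ctr i \<in> V" "\<And>i. x (Suc i) \<in> I (ctr i)"
      "\<And>i. \<exists>a\<in>I (ctr i). a \<le> x i"
    by metis
  have in_ctr: "c \<in> I (ctr (blk c))" if "c \<in> C" for c
  proof -
    obtain a where a: "a \<in> I (ctr (blk c))" "a \<le> x (blk c)" using ctr(3) by blast
    have "a \<le> c"
    proof (cases "blk c = 0")
      case True
      then show ?thesis using a x0 m(2)[OF that] by simp
    next
      case False
      then show ?thesis using blk_gt[of "blk c" c] a by simp
    qed
    then show ?thesis using conv ctr(1,2) a(1) blk_le[OF that] by blast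
  qed
  have "\<exists>w. \<forall>c\<in>C. w c \<in> V \<and> w c \<noteq> ctr (blk c) \<and> c \<in> I (w c) \<and> col (ctr (blk c)) (w c) = c"
    using nbr[OF ctr(1) in_ctr] by (intro bchoice) blast
  then obtain w where w: "\<And>c. c \<in> C \<Longrightarrow> w c \<in> V" "\<And>c. c \<in> C \<Longrightarrow> w c \<noteq> ctr (blk c)"
      "\<And>c. c \<in> C \<Longrightarrow> c \<in> I (w c)" "\<And>c. c \<in> C \<Longrightarrow> col (ctr (blk c)) (w c) = c"
    by blast
  have reach: "b \<le> x (Suc i)" if "v \<in> V" "a \<in> I v" "b \<in> I v" "a \<le> x i" for v a b i
    unfolding xS using that by (intro R_ge) (auto simp: S_def)
  define F where "F v = {c \<in> C. w c = v}" for v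
  \<comment> \<open>The block fixes the center, and the edge from that center to \<open>v\<close>
    has only one color.\<close>
  have inj: "inj_on blk (F v)" for v
    by (rule inj_onI) (metis (mono_tags, lifting) F_def mem_Collect_eq w(4))
  \<comment> \<open>\<open>v\<close> sees \<open>c\<close>, which is at most
    \<open>x (Suc (blk c))\<close>, so by \<open>reach\<close> its colors end one block
    later.\<close>
  have near: "blk d \<le> Suc (blk c)" if "c \<in> F v" "d \<in> F v" for c d v
  proof (rule ccontr)
    assume "\<not> ?thesis"
    then have "x (Suc (Suc (blk c))) < d" by (intro blk_gt) auto
    moreover have "d \<le> x (Suc (Suc (blk c)))"
      by (rule reach[of v c]) (use that w blk_le w(3)[of d] in \<open>auto simp: F_def\<close>)
    ultimately show False by simp
  qed
  have two: "card (F v) \<le> 2" for v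
  proof (cases "F v = {}")
    case False
    define i where "i = (LEAST i. i \<in> blk ` F v)"
    have i: "i \<in> blk ` F v" "\<And>j. j \<in> blk ` F v \<Longrightarrow> i \<le> j"
      unfolding i_def using False by (auto intro: LeastI Least_le)
    obtain c where c: "c \<in> F v" "i = blk c" using i(1) by blast
    have "blk ` F v \<subseteq> {i, Suc i}"
    proof
      fix k assume k: "k \<in> blk ` F v"
      then have "k \<le> Suc i" using near[OF c(1)] c(2) by blast
      then show "k \<in> {i, Suc i}" using i(2)[OF k] by auto
    qed
    then have "card (blk ` F v) \<le> card {i, Suc i}" by (intro card_mono) auto
    then show ?thesis using card_image[OF inj] by simp
  qed simp
  \<comment> \<open>For \<open>j > 0\<close> the condition is needed: \<open>x\<close> is eventually constant, and the centers of the empty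
    blocks from then on are arbitrary.\<close>
  have ctr_blk: "j = Suc (blk c)" if "c \<in> F (ctr j)" "x j < x (Suc j) \<or> j = 0" for c j
  proof -
    have c: "c \<in> C" "w c = ctr j" "c \<in> I (ctr j)"
      using that w(3)[of c] by (auto simp: F_def)
    have top: "c \<le> x (Suc j)"
      using ctr(3)[of j] reach[OF ctr(1) _ c(3)] by blast
    have "blk c \<noteq> j" using w(2) c by metis
    moreover have "\<not> j < blk c" using blk_gt[of "Suc j" c] top by auto
    ultimately have lt: "blk c < j" by simp
    have "\<not> Suc (blk c) < j"
    proof
      \<comment> \<open>\<open>ctr j\<close> would see both \<open>c\<close> and
        \<open>x (Suc j)\<close>, so the cover would already have passed \<open>x (Suc j)\<close> by
        step \<open>j\<close>.\<close>
      assume l: "Suc (blk c) < j"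
      have "x (Suc j) \<le> x (Suc (Suc (blk c)))"
        using blk_le[OF c(1)] by (intro reach[OF ctr(1) c(3) ctr(2)])
      also have "\<dots> \<le> x j" using l by (intro x_mono) simp
      finally show False using that l by simp
    qed
    with lt show ?thesis by simp
  qed
  have F0: "F (ctr 0) = {}" using ctr_blk[of _ 0] by auto
  have "C = (\<Union>v\<in>V. F v)" using w(1) by (auto simp: F_def)
  then have "card C \<le> (\<Sum>v\<in>V. card (F v))" using card_UN_le[OF fin(1), of F] by simp
  also have "\<dots> = (\<Sum>v\<in>V - {ctr 0}. card (F v))"
    using F0 ctr(1) fin by (simp add: sum.remove[of V "ctr 0"])
  also have "\<dots> \<le> 2 * card V - 3"
  proof (cases "x 1 < Max C")
    case True
    \<comment> \<open>This strict step makes \<open>ctr_blk\<close> applicable to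
      \<open>ctr 1\<close>. It also separates \<open>ctr 1\<close>, which sees \<open>x 2\<close>,
      from \<open>ctr 0\<close>, which sees nothing above \<open>x 1\<close>.\<close>
    have lt: "x 1 < x (Suc 1)" unfolding xS[of 1] using R_step[OF xC True] .
    have "card (F (ctr 1)) \<le> 1"
    proof -
      have "blk ` F (ctr 1) \<subseteq> {0}" using ctr_blk[of _ 1] lt by auto
      then have "card (blk ` F (ctr 1)) \<le> card {0::nat}" by (intro card_mono) auto
      then show ?thesis using card_image[OF inj] by simp
    qed
    moreover have ne: "ctr 1 \<noteq> ctr 0"
    proof
      assume eq: "ctr 1 = ctr 0"
      obtain a where "a \<in> I (ctr 0)" "a \<le> x 0" using ctr(3) by blast
      then have "x (Suc 1) \<le> x (Suc 0)"
        using ctr(2)[of 1] eq by (intro reach[OF ctr(1)[of 0]]) auto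
      then show False using lt by simp
    qed
    moreover have "(\<Sum>v\<in>V - {ctr 0} - {ctr 1}. card (F v)) \<le> card (V - {ctr 0} - {ctr 1}) * 2"
      using two sum_bounded_above[of "V - {ctr 0} - {ctr 1}" "\<lambda>v. card (F v)" 2] by simp
    moreover have "card (V - {ctr 0} - {ctr 1}) = card V - 2"
      using ne ctr(1) fin by (simp add: card_Diff_singleton)
    moreover have "(\<Sum>v\<in>V - {ctr 0}. card (F v))
        = card (F (ctr 1)) + (\<Sum>v\<in>V - {ctr 0} - {ctr 1}. card (F v))"
      using ne ctr(1) fin by (intro sum.remove) auto
    ultimately show ?thesis using n2 by linarith
  next
    case False
    have b0: "blk c = 0" if "c \<in> C" for c
    proof -
      have "c \<le> x 1" using False fin that by (meson Max_ge le_trans not_less)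
      then show ?thesis unfolding blk_def by (intro Least_equality) auto
    qed
    have "card (F v) \<le> 1" for v
    proof -
      have "blk ` F v \<subseteq> {0}" using b0 by (auto simp: F_def)
      then have "card (blk ` F v) \<le> card {0::nat}" by (intro card_mono) auto
      then show ?thesis using card_image[OF inj] by simp
    qed
    then have "(\<Sum>v\<in>V - {ctr 0}. card (F v)) \<le> card (V - {ctr 0})"
      using sum_bounded_above[of "V - {ctr 0}" "\<lambda>v. card (F v)" 1] by simp
    then show ?thesis using ctr(1) fin n2 by (simp add: card_Diff_singleton)
  qed
  finally show ?thesis .
qed

text \<open>Without such a vertex, seeing a color at most \<open>c\<close> passes along every edge:
  an edge at a vertex of this kind has color at most \<open>c\<close> itself, and its other end sees
  it too. A path from \<open>e\<close> to \<open>f\<close> then gives a contradiction.\<close>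

lemma connected_bridging_vertex:
  fixes \<alpha> :: "'a set \<Rightarrow> 'c::linorder"
  assumes "pair_graph G" and conn: "Digraph_Component.connected (with_proj G)"
    and e: "e \<in> edges G" "\<alpha> e \<le> c" and f: "f \<in> edges G" "c < \<alpha> f"
  shows "\<exists>v\<in>pverts G. \<exists>a\<in>\<alpha> ` incident_edges G v. \<exists>b\<in>\<alpha> ` incident_edges G v. a \<le> c \<and> c < b"
proof (rule ccontr)
  interpret pair_graph G by fact
  assume no: "\<not> ?thesis"
  obtain u u' where u: "e = {u, u'}" "(u, u') \<in> parcs G" using e by (auto simp: edges_def)
  obtain v v' where v: "f = {v, v'}" "(v, v') \<in> parcs G" using f by (auto simp: edges_def)
  \<comment> \<open>Connectedness is defined through the symmetric closure, which for a symmetric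
    digraph has the same reachability.\<close>
  have "u \<rightarrow>\<^sup>*\<^bsub>with_proj (mk_symmetric (with_proj G))\<^esub> v"
    using conn u v unfolding connected_def strongly_connected_def by (auto dest: in_arcsD1)
  then have "u \<rightarrow>\<^sup>*\<^bsub>with_proj G\<^esub> v"
    using reachable_mk_symmetric_eq[OF sym_arcs] by simp
  then have "\<exists>a\<in>\<alpha> ` incident_edges G v. a \<le> c"
  proof (induction rule: reachable_induct)
    case base
    then show ?case using e u by (auto simp: incident_edges_def)
  next
    case (step x y)
    then have xy: "(x, y) \<in> parcs G" by simp
    then have E: "{x, y} \<in> incident_edges G x" "{x, y} \<in> incident_edges G y"
      by (auto simp: incident_edges_def edges_def)
    have "x \<in> pverts G" using xy by (rule in_arcsD1)
    moreover have "\<alpha> {x, y} \<in> \<alpha> ` incident_edges G x" using E(1) by (rule imageI)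
    ultimately have "\<not> c < \<alpha> {x, y}" using no step.IH by blast
    then have "\<alpha> {x, y} \<le> c" by simp
    then show ?case using E(2) by blast
  qed
  moreover have "\<alpha> f \<in> \<alpha> ` incident_edges G v" using f v by (auto simp: incident_edges_def)
  moreover have "v \<in> pverts G" using v(2) by (rule in_arcsD1)
  ultimately show False using no f(2) by blast
qed

theorem theorem36:
  fixes G :: "'a pair_pre_digraph" and n :: nat
  assumes "pair_graph G"
    and "Digraph_Component.connected (with_proj G)"
    and "card (pverts G) = n"
    and "n \<ge> 2"
  shows "t_hat G \<le> 2 * n - 3"
proof -
  interpret pair_graph G by fact
  obtain \<alpha> where \<alpha>: "improper_interval_coloring G \<alpha>" "t_hat G = card (\<alpha> ` edges G)"
    using t_hat_attained[OF assms(1)] by blast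
  have fin: "finite (\<alpha> ` edges G)" using finite_edges[OF assms(1)] by simp
  show ?thesis
  proof (cases "edges G = {}")
    case True
    then show ?thesis using \<alpha>(2) by simp
  next
    case False
    define I where "I v = \<alpha> ` incident_edges G v" for v
    have "card (\<alpha> ` edges G) \<le> 2 * card (pverts G) - 3"
    proof (rule greedy_cover_bound[where I = I and col = "\<lambda>v w. \<alpha> {v, w}"])
      show "I v \<subseteq> \<alpha> ` edges G" for v by (auto simp: I_def incident_edges_def)
      show "c \<in> I v" if v: "v \<in> pverts G" and c: "a \<in> I v" "b \<in> I v" "a \<le> c" "c \<le> b" for v a b c
      proof -
        obtain p q where "I v = {p..q}"
          using \<alpha>(1) v unfolding improper_interval_coloring_def I_def by blast
        then show ?thesis using c by auto
      qed
      show "\<exists>v\<in>pverts G. c \<in> I v" if c: "c \<in> \<alpha> ` edges G" for c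
      proof -
        obtain u v where "(u, v) \<in> parcs G" "c = \<alpha> {u, v}"
          using c unfolding edges_def by blast
        then show ?thesis
          by (intro bexI[of _ u]) (auto simp: I_def incident_edges_def edges_def dest: in_arcsD1)
      qed
      \<comment> \<open>Only this condition draws on connectedness.\<close>
      show "\<exists>v\<in>pverts G. \<exists>a\<in>I v. \<exists>b\<in>I v. a \<le> c \<and> c < b"
        if c: "c \<in> \<alpha> ` edges G" "c < Max (\<alpha> ` edges G)" for c
      proof -
        have "Max (\<alpha> ` edges G) \<in> \<alpha> ` edges G" using fin False by (intro Max_in) auto
        then obtain f where f: "f \<in> edges G" "\<alpha> f = Max (\<alpha> ` edges G)" by (metis imageE)
        obtain e where e: "e \<in> edges G" "\<alpha> e = c" using c by blast
        show ?thesis unfolding I_def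
          using connected_bridging_vertex[OF assms(1,2) e(1) _ f(1), of \<alpha> c] e(2) f(2) c(2) by simp
      qed
      show "\<exists>w\<in>pverts G. w \<noteq> v \<and> c \<in> I w \<and> \<alpha> {v, w} = c" if c: "c \<in> I v" for v c
      proof -
        obtain e where e: "e \<in> edges G" "v \<in> e" "c = \<alpha> e"
          using c by (auto simp: I_def incident_edges_def)
        \<comment> \<open>\<open>v\<close> may be either end of \<open>e\<close>; symmetry of the
          arcs lets it come first.\<close>
        then obtain w where w: "e = {v, w}" "(v, w) \<in> parcs G"
          using arcs_symmetric by (auto simp: edges_def insert_commute)
        then have "w \<in> pverts G" "w \<noteq> v" using no_loops'[of v] by (auto dest: in_arcsD2)
        then show ?thesis using e w by (auto simp: I_def incident_edges_def)
      qed
    qed (use fin False assms in auto)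
    then show ?thesis using \<alpha>(2) assms(3) by simp
  qed
qed

end
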